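(* Let $P$ be a polyomino with $n=2m-1$ tiles that admits a set $S$ of $m=\lceil n/2\rceil$ non-attacking rooks. Then $S$ dominates $P$, and $S$ is the only set of $m$ non-attacking rooks on $P$.
   Context: A polyomino is a finite union of unit squares (tiles) of the standard grid in $\mathbb{R}^2$ with connected interior. Two tiles of $P$ are in the same row (resp. column) of $P$ if the segment joining their centers is horizontal (resp. vertical) and contained in $P$. A rook on a tile guards that tile and every tile in the same row or column of $P$. A set of rooks dominates $P$ if every tile is guarded by some rook. A set of rooks on distinct tiles is non-attacking if no two are in the same row or column of $P$. *)

theory Defs
  imports "HOL-Analysis.Analysis"
begin

text \<open>A tile of the grid is addressed by the integer coordinates of its lower left corner.\<close>

definition unit_square :: "int \<times> int \<Rightarrow> (real \<times> real) set" where
  "unit_square c = cbox (of_int (fst c), of_int (snd c)) (of_int (fst c) + 1, of_int (snd c) + 1)"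

definition center :: "int \<times> int \<Rightarrow> real \<times> real" where
  "center c = (of_int (fst c) + 1 / 2, of_int (snd c) + 1 / 2)"

definition polyomino :: "(real \<times> real) set \<Rightarrow> bool" where
  "polyomino P \<longleftrightarrow> (\<exists>C. finite C \<and> P = (\<Union>c\<in>C. unit_square c)) \<and> connected (interior P)"

definition tiles :: "(real \<times> real) set \<Rightarrow> (int \<times> int) set" where
  "tiles P = {c. unit_square c \<subseteq> P}"

text \<open>Both relations are reflexive on the tiles of \<open>P\<close> (the segment degenerates to a point).\<close>

definition same_row :: "(real \<times> real) set \<Rightarrow> int \<times> int \<Rightarrow> int \<times> int \<Rightarrow> bool" where
  "same_row P a b \<longleftrightarrow> a \<in> tiles P \<and> b \<in> tiles P \<and>
     snd (center a) = snd (center b) \<and> closed_segment (center a) (center b) \<subseteq> P"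

definition same_column :: "(real \<times> real) set \<Rightarrow> int \<times> int \<Rightarrow> int \<times> int \<Rightarrow> bool" where
  "same_column P a b \<longleftrightarrow> a \<in> tiles P \<and> b \<in> tiles P \<and>
     fst (center a) = fst (center b) \<and> closed_segment (center a) (center b) \<subseteq> P"

definition guards :: "(real \<times> real) set \<Rightarrow> int \<times> int \<Rightarrow> int \<times> int \<Rightarrow> bool" where
  "guards P r t \<longleftrightarrow> r = t \<or> same_row P r t \<or> same_column P r t"

definition dominates :: "(int \<times> int) set \<Rightarrow> (real \<times> real) set \<Rightarrow> bool" where
  "dominates S P \<longleftrightarrow> S \<subseteq> tiles P \<and> (\<forall>t\<in>tiles P. \<exists>r\<in>S. guards P r t)"

definition non_attacking :: "(real \<times> real) set \<Rightarrow> (int \<times> int) set \<Rightarrow> bool" where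
  "non_attacking P S \<longleftrightarrow> S \<subseteq> tiles P \<and>
     (\<forall>a\<in>S. \<forall>b\<in>S. a \<noteq> b \<longrightarrow> \<not> same_row P a b \<and> \<not> same_column P a b)"

lemma center_in_unit_square_iff: "center c \<in> unit_square d \<longleftrightarrow> c = d"
proof -
  have "real_of_int i \<le> real_of_int j + 1 / 2 \<and> real_of_int j + 1 / 2 \<le> real_of_int i + 1
          \<longleftrightarrow> j = i" for i j
    by linarith
  then show ?thesis
    by (cases c; cases d) (simp add: center_def unit_square_def cbox_Pair_eq)
qed

text \<open>The tiles of a union of unit squares are exactly the squares it was built from, so
  \<open>card (tiles P)\<close> is the number of tiles of \<open>P\<close>.\<close>

lemma tiles_Union_unit_square: "tiles (\<Union>c\<in>C. unit_square c) = C"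
proof
  show "tiles (\<Union>c\<in>C. unit_square c) \<subseteq> C"
  proof
    fix d assume "d \<in> tiles (\<Union>c\<in>C. unit_square c)"
    then have "center d \<in> (\<Union>c\<in>C. unit_square c)"
      using center_in_unit_square_iff[of d d] unfolding tiles_def by blast
    then show "d \<in> C" by (simp add: center_in_unit_square_iff)
  qed
qed (auto simp: tiles_def)

end

theory Submission imports Defs begin

text \<open>Let the rows and columns of \<open>P\<close> be the vertices of a bipartite graph whose edges are the
  tiles. It is connected with \<open>2m - 1\<close> edges, hence has at most \<open>2m\<close> vertices, and \<open>m\<close>
  non-attacking rooks form a matching that covers \<open>2m\<close> of them. So the graph is a tree and the
  matching is perfect, which gives domination; a tree has at most one perfect matching.\<close>

section \<open>Connected edge sets and matchings in a bipartite graph\<close>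

text \<open>With \<open>r\<close> and \<open>c\<close> giving the row and the column of a tile, these are the connected sets
  of edges, built up one edge at a time.\<close>

inductive grown :: "('a \<Rightarrow> 'r) \<Rightarrow> ('a \<Rightarrow> 'c) \<Rightarrow> 'a set \<Rightarrow> bool" for r c where
  singleton: "grown r c {t}"
| insert: "grown r c T \<Longrightarrow> t \<notin> T \<Longrightarrow> r t \<in> r ` T \<or> c t \<in> c ` T \<Longrightarrow> grown r c (insert t T)"

lemma grown_finite: "grown r c T \<Longrightarrow> finite T"
  by (induction rule: grown.induct) auto

text \<open>Each added edge shares an endpoint with the earlier ones, so it brings at most one new
  vertex; the first edge has two.\<close>

lemma grown_card_le:
  assumes "grown r c T"
  shows "card (r ` T) + card (c ` T) \<le> card T + 1"
  using assms
proof (induction rule: grown.induct)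
  case (insert T t)
  then show ?case
    using grown_finite[OF insert.hyps(1)] by (auto simp: card_insert_if)
qed simp

text \<open>By injectivity, deleting \<open>t\<close> removes exactly \<open>f t\<close> from the
  image if \<open>t\<close> was present, and nothing otherwise.\<close>

lemma image_remove_eq:
  assumes "inj_on f S" "inj_on f S'" "f ` S = f ` S'" "t \<in> S \<longleftrightarrow> t \<in> S'"
  shows "f ` (S - {t}) = f ` (S' - {t})"
proof -
  have "f ` (U - {t}) = f ` U - (if t \<in> U then {f t} else {})" if "inj_on f U" for U
    using that by (auto simp: inj_on_def)
  with assms show ?thesis by simp
qed

text \<open>Here \<open>f t\<close> is a leaf: no edge of \<open>T\<close> ends there, so a set of
  edges covers it only by containing \<open>t\<close>.\<close>

lemma mem_iff_if_image_eq:
  assumes "S \<subseteq> insert t T" "S' \<subseteq> insert t T" "f t \<notin> f ` T" "f ` S = f ` S'"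
  shows "t \<in> S \<longleftrightarrow> t \<in> S'"
proof -
  have "f t \<in> f ` U \<longleftrightarrow> t \<in> U" if "U \<subseteq> insert t T" for U
    using assms(3) that by blast
  with assms(1,2,4) show ?thesis by metis
qed

text \<open>Equality in the bound of \<open>grown_card_le\<close> means that the graph is a tree; its last
  edge then ends in a leaf, so whether that edge belongs to a perfect matching is forced.\<close>

lemma grown_matching_unique:
  assumes "grown r c T" "card (r ` T) + card (c ` T) = card T + 1"
    and "S \<subseteq> T" "S' \<subseteq> T" "inj_on r S" "inj_on c S" "inj_on r S'" "inj_on c S'"
    and "r ` S = r ` S'" "c ` S = c ` S'"
  shows "S = S'"
  using assms
proof (induction arbitrary: S S' rule: grown.induct)
  case (singleton t)
  then show ?case by (auto simp: subset_singleton_iff)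
next
  case (insert T t)
  note fin = grown_finite[OF insert.hyps(1)] and le = grown_card_le[OF insert.hyps(1)]
  have "card (r ` insert t T) = (if r t \<in> r ` T then card (r ` T) else Suc (card (r ` T)))"
    "card (c ` insert t T) = (if c t \<in> c ` T then card (c ` T) else Suc (card (c ` T)))"
    "card (insert t T) = Suc (card T)"
    using fin insert.hyps(2) by (simp_all add: card_insert_if)
  \<comment> \<open>One endpoint of \<open>t\<close> is old, so the vertex count grows by at most
    one while the edge count grows by exactly one. Equality after the step therefore forces equality
    for \<open>T\<close> and exactly one new endpoint.\<close>
  then have eq: "card (r ` T) + card (c ` T) = card T + 1"
    and leaf: "r t \<notin> r ` T \<or> c t \<notin> c ` T"
    using insert.prems(1) insert.hyps(3) le by (simp_all split: if_splits)
  have mem: "t \<in> S \<longleftrightarrow> t \<in> S'"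
    using leaf
  proof
    assume "r t \<notin> r ` T"
    with insert.prems(2,3,8) show ?thesis by (intro mem_iff_if_image_eq)
  next
    assume "c t \<notin> c ` T"
    with insert.prems(2,3,9) show ?thesis by (intro mem_iff_if_image_eq)
  qed
  \<comment> \<open>What remains need not cover all vertices of \<open>T\<close>. The induction asks
    only that both matchings cover the same vertices, and this survives the deletion of
    \<open>t\<close>.\<close>
  have "S - {t} = S' - {t}"
  proof (rule insert.IH[OF eq])
    show "r ` (S - {t}) = r ` (S' - {t})"
      using insert.prems(4,6,8) mem by (intro image_remove_eq)
    show "c ` (S - {t}) = c ` (S' - {t})"
      using insert.prems(5,7,9) mem by (intro image_remove_eq)
  qed (use insert.prems in \<open>auto intro: inj_on_diff\<close>)
  with mem show ?case by blast
qed

text \<open>Greedy growth from any single edge never gets stuck before reaching \<open>C\<close>, so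
  grown subsets of every size from 1 to \<open>card C\<close> exist; the one of full size is
  \<open>C\<close>.\<close>

lemma grown_exhausts:
  assumes "finite C" "C \<noteq> {}"
    and "\<And>T. T \<subseteq> C \<Longrightarrow> T \<noteq> {} \<Longrightarrow> T \<noteq> C \<Longrightarrow> \<exists>t\<in>C - T. r t \<in> r ` T \<or> c t \<in> c ` T"
  shows "grown r c C"
proof -
  have "\<exists>T\<subseteq>C. card T = Suc k \<and> grown r c T" if "Suc k \<le> card C" for k
    using that
  proof (induction k)
    case 0
    obtain t where "t \<in> C" using assms(2) by blast
    then show ?case by (intro exI[of _ "{t}"]) (auto intro: grown.singleton)
  next
    case (Suc k)
    then obtain T where T: "T \<subseteq> C" "card T = Suc k" "grown r c T" by auto
    with Suc.prems have "T \<noteq> {}" "T \<noteq> C" by auto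
    with assms(3) T obtain t where t: "t \<in> C - T" "r t \<in> r ` T \<or> c t \<in> c ` T" by metis
    have "grown r c (insert t T)" using T t by (intro grown.insert) auto
    then show ?case
      using T t grown_finite[OF T(3)] by (intro exI[of _ "insert t T"]) auto
  qed
  from this[of "card C - 1"] assms(1,2) show ?thesis
    by (metis Suc_diff_1 card_gt_0_iff card_subset_eq order_refl)
qed

section \<open>Rows and columns as equivalence classes of tiles\<close>

lemma same_row_iff:
  "same_row P a b \<longleftrightarrow> a \<in> tiles P \<and> b \<in> tiles P \<and> snd a = snd b \<and>
     closed_segment (of_int (fst a) + 1/2 :: real) (of_int (fst b) + 1/2) \<times> {of_int (snd a) + 1/2} \<subseteq> P"
  unfolding same_row_def by (auto simp: center_def closed_segment_same_snd)

lemma same_column_iff: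
  "same_column P a b \<longleftrightarrow> a \<in> tiles P \<and> b \<in> tiles P \<and> fst a = fst b \<and>
     {of_int (fst a) + 1/2} \<times> closed_segment (of_int (snd a) + 1/2 :: real) (of_int (snd b) + 1/2) \<subseteq> P"
  unfolding same_column_def by (auto simp: center_def closed_segment_same_fst)

lemma unit_square_eq:
  "unit_square (i, j) = {of_int i..of_int i + 1} \<times> {of_int j..of_int j + 1}"
  by (simp add: unit_square_def cbox_Pair_eq)

lemma same_row_sym: "same_row P a b \<Longrightarrow> same_row P b a"
  by (simp add: same_row_def closed_segment_commute)

lemma same_column_sym: "same_column P a b \<Longrightarrow> same_column P b a"
  by (simp add: same_column_def closed_segment_commute)

lemma closed_segment_real_min_max: "closed_segment a b = {min a b..max a (b::real)}"
  unfolding closed_segment_eq_real_ivl min_def max_def by simp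

text \<open>Since \<open>b\<close> may lie anywhere, transitivity of rows and columns follows
  without cases on the order of the three tiles.\<close>

lemma closed_segment_subset_Un_real:
  fixes a b c :: real
  shows "closed_segment a c \<subseteq> closed_segment a b \<union> closed_segment b c"
proof
  fix x assume "x \<in> closed_segment a c"
  then have "min a c \<le> x" "x \<le> max a c"
    by (simp_all only: closed_segment_real_min_max atLeastAtMost_iff)
  then have "min a b \<le> x \<and> x \<le> max a b \<or> min b c \<le> x \<and> x \<le> max b c"
    by linarith
  then show "x \<in> closed_segment a b \<union> closed_segment b c"
    by (simp only: closed_segment_real_min_max atLeastAtMost_iff Un_iff)
qed

lemma same_row_trans:
  assumes "same_row P a b" "same_row P b c"
  shows "same_row P a c"
proof -
  let ?seg = "\<lambda>u v. closed_segment (of_int (fst u) + 1/2 :: real) (of_int (fst v) + 1/2) \<times>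
    {of_int (snd a) + 1/2 :: real}"
  have "snd b = snd a" "snd c = snd a"
    using assms by (simp_all add: same_row_iff)
  then have "?seg a b \<subseteq> P" "?seg b c \<subseteq> P"
    using assms unfolding same_row_iff by metis+
  moreover have "?seg a c \<subseteq> ?seg a b \<union> ?seg b c"
    unfolding Sigma_Un_distrib1[symmetric]
    by (intro Sigma_mono closed_segment_subset_Un_real order_refl)
  ultimately have "?seg a c \<subseteq> P" by (meson Un_least order_trans)
  then show ?thesis
    using assms unfolding same_row_iff by metis
qed

lemma same_column_trans:
  assumes "same_column P a b" "same_column P b c"
  shows "same_column P a c"
proof -
  let ?seg = "\<lambda>u v. {of_int (fst a) + 1/2 :: real} \<times>
    closed_segment (of_int (snd u) + 1/2 :: real) (of_int (snd v) + 1/2)"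
  have "fst b = fst a" "fst c = fst a"
    using assms by (simp_all add: same_column_iff)
  then have "?seg a b \<subseteq> P" "?seg b c \<subseteq> P"
    using assms unfolding same_column_iff by metis+
  moreover have "?seg a c \<subseteq> ?seg a b \<union> ?seg b c"
    unfolding Sigma_Un_distrib2[symmetric]
    by (intro Sigma_mono closed_segment_subset_Un_real order_refl)
  ultimately have "?seg a c \<subseteq> P" by (meson Un_least order_trans)
  then show ?thesis
    using assms unfolding same_column_iff by metis
qed

text \<open>The two squares already contain the segment between the centers. Distance 0 is included
  so that reflexivity on tiles is a special case.\<close>

lemma same_row_adjacent:
  assumes "(i, j) \<in> tiles P" "(i', j) \<in> tiles P" "\<bar>i - i'\<bar> \<le> 1"
  shows "same_row P (i, j) (i', j)"
proof -
  have "closed_segment (of_int i + 1/2) (of_int i' + 1/2) \<times> {of_int j + 1/2 :: real}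
      \<subseteq> unit_square (i, j) \<union> unit_square (i', j)"
    using assms(3) by (auto simp: unit_square_eq closed_segment_eq_real_ivl split: if_splits)
  with assms show ?thesis by (auto simp: same_row_iff tiles_def)
qed

lemma same_column_adjacent:
  assumes "(i, j) \<in> tiles P" "(i, j') \<in> tiles P" "\<bar>j - j'\<bar> \<le> 1"
  shows "same_column P (i, j) (i, j')"
proof -
  have "{of_int i + 1/2 :: real} \<times> closed_segment (of_int j + 1/2) (of_int j' + 1/2)
      \<subseteq> unit_square (i, j) \<union> unit_square (i, j')"
    using assms(3) by (auto simp: unit_square_eq closed_segment_eq_real_ivl split: if_splits)
  with assms show ?thesis by (auto simp: same_column_iff tiles_def)
qed

text \<open>A vertex of the graph, encoded as the equivalence class of a tile, so that sharing a
  vertex becomes an equality of values.\<close>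

definition row_of :: "(real \<times> real) set \<Rightarrow> int \<times> int \<Rightarrow> (int \<times> int) set" where
  "row_of P a = Collect (same_row P a)"

definition column_of :: "(real \<times> real) set \<Rightarrow> int \<times> int \<Rightarrow> (int \<times> int) set" where
  "column_of P a = Collect (same_column P a)"

lemma row_of_eq_iff:
  assumes "a \<in> tiles P" "b \<in> tiles P"
  shows "row_of P a = row_of P b \<longleftrightarrow> same_row P a b"
proof
  have "b \<in> row_of P b"
    using same_row_adjacent[of "fst b" "snd b" P "fst b"] assms(2) by (simp add: row_of_def)
  moreover assume "row_of P a = row_of P b"
  ultimately have "b \<in> row_of P a"
    by (simp only:)
  then show "same_row P a b"
    by (simp add: row_of_def)
next
  assume "same_row P a b"
  then have "same_row P a x = same_row P b x" for x
    using same_row_trans[of P a b x] same_row_trans[of P b a x] same_row_sym[of P a b] by blast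
  then have "same_row P a = same_row P b" by (rule ext)
  then show "row_of P a = row_of P b"
    by (simp only: row_of_def)
qed

lemma column_of_eq_iff:
  assumes "a \<in> tiles P" "b \<in> tiles P"
  shows "column_of P a = column_of P b \<longleftrightarrow> same_column P a b"
proof
  have "b \<in> column_of P b"
    using same_column_adjacent[of "fst b" "snd b" P "snd b"] assms(2) by (simp add: column_of_def)
  moreover assume "column_of P a = column_of P b"
  ultimately have "b \<in> column_of P a"
    by (simp only:)
  then show "same_column P a b"
    by (simp add: column_of_def)
next
  assume "same_column P a b"
  then have "same_column P a x = same_column P b x" for x
    using same_column_trans[of P a b x] same_column_trans[of P b a x] same_column_sym[of P a b] by blast
  then have "same_column P a = same_column P b" by (rule ext)
  then show "column_of P a = column_of P b"
    by (simp only: column_of_def)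
qed

section \<open>Connectedness of the graph of rows and columns\<close>

lemma center_in_interior:
  assumes "a \<in> tiles P"
  shows "center a \<in> interior P"
proof -
  have "center a \<in> interior (unit_square a)"
    by (cases a) (simp add: center_def unit_square_eq interior_Times)
  with assms show ?thesis using interior_mono unfolding tiles_def by blast
qed

text \<open>If no tile of \<open>T\<close> shared an edge with a tile outside \<open>T\<close>, the two parts of \<open>P\<close> would meet
  in corners only. Deleting finitely many points keeps the interior of \<open>P\<close> connected.\<close>

lemma polyomino_linked:
  assumes "polyomino P" "T \<subseteq> tiles P" "T \<noteq> {}" "T \<noteq> tiles P"
  shows "\<exists>t\<in>tiles P - T. \<exists>u\<in>T. same_row P t u \<or> same_column P t u"
proof (rule ccontr)
  assume neg: "\<not> ?thesis"
  define C where "C = tiles P"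
  have C: "finite C" "P = (\<Union>c\<in>C. unit_square c)" and conn: "connected (interior P)"
    using assms(1) tiles_Union_unit_square unfolding polyomino_def C_def by metis+
  \<comment> \<open>All corners of the tiles of \<open>P\<close>.\<close>
  define F where "F = (\<lambda>(i, j). (real_of_int i, real_of_int j)) `
    (\<Union>c\<in>C. {fst c, fst c + 1} \<times> {snd c, snd c + 1})"
  define A where "A = (\<Union>c\<in>T. unit_square c)"
  define B where "B = (\<Union>c\<in>C - T. unit_square c)"
  have "finite F" using C(1) unfolding F_def by auto
  then have "connected (interior P - F)"
    using conn by (intro connected_open_delete_finite) auto
  moreover have "closed A" "closed B"
    using C(1) assms(2) unfolding A_def B_def C_def
    by (auto intro!: closed_UN intro: finite_subset simp: unit_square_def)
  moreover have "interior P - F \<subseteq> A \<union> B"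
    using interior_subset[of P] C(2) unfolding A_def B_def by blast
  moreover have "A \<inter> B \<inter> (interior P - F) = {}"
  proof -
    have "(x, y) \<in> F" if "(i, j) \<in> T" "(i', j') \<in> C - T"
      and "(x, y) \<in> unit_square (i, j)" "(x, y) \<in> unit_square (i', j')" for i j i' j' x y
    proof -
      have "\<bar>i - i'\<bar> \<le> 1" "\<bar>j - j'\<bar> \<le> 1"
        using that(3,4) unfolding unit_square_eq by (auto; linarith)+
      \<comment> \<open>Two touching squares that agree in one coordinate would share a row or a
        column, against \<open>neg\<close>. So they are diagonal neighbours and meet in a
        corner.\<close>
      moreover from this have "i \<noteq> i'" "j \<noteq> j'"
        using neg that(1,2) assms(2) same_row_adjacent[of i' j P i] same_column_adjacent[of i j' P j]
        unfolding C_def by (auto simp: abs_minus_commute)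
      ultimately have "i' = i - 1 \<or> i' = i + 1" "j' = j - 1 \<or> j' = j + 1"
        by linarith+
      then have "(x = of_int i \<or> x = of_int (i + 1)) \<and> (y = of_int j \<or> y = of_int (j + 1))"
        using that(3,4) unfolding unit_square_eq by auto
      moreover have "(i, j) \<in> C" using that(1) assms(2) C_def by auto
      ultimately show ?thesis unfolding F_def by force
    qed
    then show ?thesis unfolding A_def B_def by fast
  qed
  ultimately have sep: "A \<inter> (interior P - F) = {} \<or> B \<inter> (interior P - F) = {}"
    by (intro connected_closedD)
  \<comment> \<open>Centers have half-integer coordinates, so they survive the deletion of the
    corners and witness that both \<open>A\<close> and \<open>B\<close> meet the remaining
    set.\<close>
  have center: "center c \<in> interior P - F" if "c \<in> C" for c
  proof -
    have "real_of_int i + 1/2 \<noteq> real_of_int k" for i k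
    proof
      assume "real_of_int i + 1/2 = real_of_int k"
      then have "i < k" "k < i + 1" by linarith+
      then show False by simp
    qed
    then have "center c \<notin> F" unfolding F_def center_def by auto
    then show ?thesis using center_in_interior that unfolding C_def by simp
  qed
  have "C - T \<noteq> {}"
    using assms(2,4) unfolding C_def by (metis Diff_eq_empty_iff subset_antisym)
  then obtain c d where c: "c \<in> T" and d: "d \<in> C - T"
    using assms(3) by (metis ex_in_conv)
  then have "center c \<in> A" "center d \<in> B"
    unfolding A_def B_def UN_iff by (metis center_in_unit_square_iff)+
  moreover have "center c \<in> interior P - F" "center d \<in> interior P - F"
    using c d center assms(2) unfolding C_def by (metis subsetD DiffD1)+
  ultimately show False using sep by (metis IntI empty_iff)
qed

lemma polyomino_grown:
  assumes "polyomino P" "tiles P \<noteq> {}"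
  shows "grown (row_of P) (column_of P) (tiles P)"
proof (rule grown_exhausts)
  show "finite (tiles P)"
    using assms(1) tiles_Union_unit_square unfolding polyomino_def by metis
next
  fix T assume T: "T \<subseteq> tiles P" "T \<noteq> {}" "T \<noteq> tiles P"
  obtain t u where tu: "t \<in> tiles P - T" "u \<in> T" "same_row P t u \<or> same_column P t u"
    using polyomino_linked[OF assms(1) T] by blast
  then have "row_of P t = row_of P u \<or> column_of P t = column_of P u"
    using T row_of_eq_iff column_of_eq_iff by (metis DiffD1 subsetD)
  with tu show "\<exists>t\<in>tiles P - T. row_of P t \<in> row_of P ` T \<or> column_of P t \<in> column_of P ` T"
    by blast
qed (use assms in simp)

section \<open>Non-attacking rooks as matchings\<close>

lemma non_attacking_inj_on:
  assumes "non_attacking P S"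
  shows "inj_on (row_of P) S" "inj_on (column_of P) S"
  using assms unfolding non_attacking_def inj_on_def
  by (metis row_of_eq_iff subsetD) (metis assms non_attacking_def column_of_eq_iff subsetD)

theorem theorem19:
  fixes P :: "(real \<times> real) set" and S :: "(int \<times> int) set" and n m :: nat
  assumes "polyomino P"
    and "n = card (tiles P)"
    and "int n = 2 * int m - 1"
    and "int m = \<lceil>real n / 2\<rceil>"
    and "non_attacking P S"
    and "card S = m"
  shows "dominates S P \<and> (\<forall>S'. non_attacking P S' \<and> card S' = m \<longrightarrow> S' = S)"
proof -
  let ?C = "tiles P" and ?r = "row_of P" and ?c = "column_of P"
  \<comment> \<open>The number of tiles is odd, hence nonzero. As infinite sets have
    \<open>card\<close> 0, this yields finiteness as well as nonemptiness.\<close>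
  have "card ?C \<noteq> 0" using assms(2,3) by presburger
  then have fin: "finite ?C" and "?C \<noteq> {}" by (auto intro: ccontr)
  then have grown: "grown ?r ?c ?C" using polyomino_grown[OF assms(1)] by blast
  have cards: "card (?r ` U) = m" "card (?c ` U) = m" "?r ` U \<subseteq> ?r ` ?C" "?c ` U \<subseteq> ?c ` ?C"
    if "non_attacking P U" "card U = m" for U
    using that non_attacking_inj_on[OF that(1)] by (auto simp: card_image non_attacking_def)
  \<comment> \<open>There are at least \<open>m\<close> rows and at least \<open>m\<close> columns,
    but at most \<open>2 * m\<close> of both together, so each count is exactly
    \<open>m\<close>.\<close>
  have "m \<le> card (?r ` ?C)" "m \<le> card (?c ` ?C)"
    using cards[OF assms(5,6)] fin by (metis card_mono finite_imageI)+
  moreover have le: "card (?r ` ?C) + card (?c ` ?C) \<le> 2 * m" "card ?C + 1 = 2 * m"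
    using grown_card_le[OF grown] assms(2,3) by linarith+
  ultimately have eq: "card (?r ` ?C) = m" "card (?c ` ?C) = m" by linarith+
  \<comment> \<open>Any \<open>m\<close> non-attacking rooks thus form a perfect matching, for
    \<open>S\<close> and a competing \<open>S'\<close> alike.\<close>
  have onto: "?r ` U = ?r ` ?C" "?c ` U = ?c ` ?C" if "non_attacking P U" "card U = m" for U
    using cards[OF that] eq fin by (simp_all add: card_subset_eq)
  have "dominates S P"
    unfolding dominates_def
  proof (intro conjI ballI)
    show "S \<subseteq> ?C" using assms(5) by (simp add: non_attacking_def)
    fix t assume t: "t \<in> ?C"
    then have "?r t \<in> ?r ` S" using onto[OF assms(5,6)] by blast
    \<comment> \<open>The rook in the row of \<open>t\<close> guards it.\<close>
    then obtain s where "s \<in> S" "?r s = ?r t" by (metis imageE)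
    then show "\<exists>s\<in>S. guards P s t"
      using t \<open>S \<subseteq> ?C\<close> row_of_eq_iff unfolding guards_def by blast
  qed
  moreover have "S' = S" if S': "non_attacking P S'" "card S' = m" for S'
  proof (rule grown_matching_unique[OF grown])
    show "card (?r ` ?C) + card (?c ` ?C) = card ?C + 1" using eq le by linarith
  qed (use S' assms(5,6) onto non_attacking_inj_on in \<open>auto simp: non_attacking_def\<close>)
  ultimately show ?thesis by blast
qed

end
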